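(* Let $\varphi\colon R\to S$ be any ring morphism and $(\mathfrak a,M)$, with $\mathfrak a=\ker(\varphi)$ and $M=\varphi^{-1}(U(S))$, its corresponding element in $\operatorname{Hom}(R)$. Then $\varphi$ is the composite ring morphism of mappings $$R\xrightarrow{\ \pi\ }R/\mathfrak a\xrightarrow{\ \chi\ }S_{(R/\mathfrak a,M/\mathfrak a)}\xrightarrow{\ g\ }T\xrightarrow{\ \varepsilon\ }S,$$ where $\pi$ is the canonical projection, $\chi=\chi_{(R/\mathfrak a,M/\mathfrak a)}$ is the canonical morphism, $T$ is the subring of $S$ generated by $\varphi(R)$ and the inverses $\varphi(m)^{-1}$ of the images of the elements $m\in M$, $g\colon S_{(R/\mathfrak a,M/\mathfrak a)}\to T$ is a surjective ring epimorphism, and $\varepsilon\colon T\to S$ is the ring embedding.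
   Context: All rings are associative with identity $1\neq 0$ and ring morphisms send $1$ to $1$. $U(S)$ denotes the group of two-sided invertible elements of a ring $S$. $\operatorname{Hom}(R)$ denotes the set of all pairs $(\ker(\varphi),\varphi^{-1}(U(S)))$ where $\varphi\colon R\to S$ is a ring morphism into an arbitrary ring $S$; $M/\mathfrak a:=\{m+\mathfrak a\mid m\in M\}$. A ring morphism $\varphi\colon R\to S$ is a ring epimorphism if for all ring morphisms $\psi,\psi'\colon S\to T$, $\psi\varphi=\psi'\varphi$ implies $\psi=\psi'$. For a ring $R$ and a subset $N\subseteq R$, let $X=\{x_n\mid n\in N\}$ be a set of non-commuting indeterminates in bijection with $N$, and let $R\{X\}$ be the free $R$-ring over $X$: there are a ring morphism $R\to R\{X\}$ and a map $X\to R\{X\}$ such that for every ring $S$, every ring morphism $\psi\colon R\to S$ and every map $\zeta\colon X\to S$, there is a unique ring morphism $R\{X\}\to S$ extending both $\psi$ and $\zeta$ (the indeterminates are not assumed to commute with elements of $R$). Let $I$ be the two-sided ideal of $R\{X\}$ generated by $\{x_nn-1\mid n\in N\}\cup\{nx_n-1\mid n\in N\}$. Put $S_{(R,N)}:=R\{X\}/I$ and let $\chi_{(R,N)}\colon R\to S_{(R,N)}$ be the composite of $R\to R\{X\}$ and the canonical projection. *)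

theory Defs
  imports "HOL-Algebra.QuotRing" "HOL-Algebra.Generated_Rings"
begin

text \<open>
  The library's \<open>ring\<close> is associative and unital, not necessarily commutative, but it
  admits the zero ring; \<open>ring_hom\<close> preserves the identity.
\<close>

definition nz_ring :: "('a, 'm) ring_scheme \<Rightarrow> bool" where
  "nz_ring R \<longleftrightarrow> ring R \<and> \<one>\<^bsub>R\<^esub> \<noteq> \<zero>\<^bsub>R\<^esub>"

definition ring_mor ::
  "('a, 'm) ring_scheme \<Rightarrow> ('b, 'n) ring_scheme \<Rightarrow> ('a \<Rightarrow> 'b) \<Rightarrow> bool" where
  "ring_mor R S f \<longleftrightarrow> nz_ring R \<and> nz_ring S \<and> f \<in> ring_hom R S"

text \<open>
  The test object \<open>U\<close> ranges over all rings whose elements have the type \<open>'c\<close>. A theorem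
  in which \<open>'c\<close> is a free type variable thereby quantifies over all test rings. If the
  morphism is itself existentially quantified, a uniqueness clause is needed to make it
  independent of \<open>'c\<close>.
\<close>

definition ring_epi ::
  "'c itself \<Rightarrow> ('a, 'm) ring_scheme \<Rightarrow> ('b, 'n) ring_scheme \<Rightarrow> ('a \<Rightarrow> 'b) \<Rightarrow> bool" where
  "ring_epi (_ :: 'c itself) R S f \<longleftrightarrow> ring_mor R S f \<and>
     (\<forall>(U :: 'c ring) \<psi> \<psi>'. ring_mor S U \<psi> \<longrightarrow> ring_mor S U \<psi>' \<longrightarrow>
        (\<forall>r\<in>carrier R. \<psi> (f r) = \<psi>' (f r)) \<longrightarrow> (\<forall>s\<in>carrier S. \<psi> s = \<psi>' s))"

text \<open>The element of \<open>Hom(R)\<close> that corresponds to a morphism \<open>f\<close>.\<close>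

definition hom_pair ::
  "('a, 'm) ring_scheme \<Rightarrow> ('b, 'n) ring_scheme \<Rightarrow> ('a \<Rightarrow> 'b) \<Rightarrow> 'a set \<times> 'a set" where
  "hom_pair R S f = (a_kernel R S f, {r \<in> carrier R. f r \<in> Units S})"


subsection \<open>The free ring over a ring\<close>

text \<open>
  The free \<open>R\<close>-ring \<open>R{V}\<close> over a set \<open>V\<close> of indeterminates is the set of formal ring
  expressions in constants from \<open>R\<close> and indeterminates from \<open>V\<close>, modulo the congruence
  generated by the ring axioms and by the addition and multiplication tables of \<open>R\<close>.
  Constants and indeterminates are not made to commute. The universal property, for test
  rings with elements of any type, is \<open>free_ring_universal\<close> below.
\<close>

datatype ('a, 'x) rterm =
    Cst 'a
  | Ind 'x
  | Plus "('a, 'x) rterm" "('a, 'x) rterm"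
  | Times "('a, 'x) rterm" "('a, 'x) rterm"
  | Minus "('a, 'x) rterm"

inductive_set rterms :: "('a, 'm) ring_scheme \<Rightarrow> 'x set \<Rightarrow> ('a, 'x) rterm set"
  for R and V where
    Cst: "r \<in> carrier R \<Longrightarrow> Cst r \<in> rterms R V"
  | Ind: "x \<in> V \<Longrightarrow> Ind x \<in> rterms R V"
  | Plus: "s \<in> rterms R V \<Longrightarrow> t \<in> rterms R V \<Longrightarrow> Plus s t \<in> rterms R V"
  | Times: "s \<in> rterms R V \<Longrightarrow> t \<in> rterms R V \<Longrightarrow> Times s t \<in> rterms R V"
  | Minus: "s \<in> rterms R V \<Longrightarrow> Minus s \<in> rterms R V"

inductive rterm_eq ::
  "('a, 'm) ring_scheme \<Rightarrow> 'x set \<Rightarrow> ('a, 'x) rterm \<Rightarrow> ('a, 'x) rterm \<Rightarrow> bool"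
  for R and V where
    refl: "s \<in> rterms R V \<Longrightarrow> rterm_eq R V s s"
  | sym: "rterm_eq R V s t \<Longrightarrow> rterm_eq R V t s"
  | trans: "rterm_eq R V s t \<Longrightarrow> rterm_eq R V t u \<Longrightarrow> rterm_eq R V s u"
  | Plus: "rterm_eq R V s s' \<Longrightarrow> rterm_eq R V t t' \<Longrightarrow> rterm_eq R V (Plus s t) (Plus s' t')"
  | Times: "rterm_eq R V s s' \<Longrightarrow> rterm_eq R V t t' \<Longrightarrow> rterm_eq R V (Times s t) (Times s' t')"
  | Minus: "rterm_eq R V s s' \<Longrightarrow> rterm_eq R V (Minus s) (Minus s')"
  | add_assoc: "s \<in> rterms R V \<Longrightarrow> t \<in> rterms R V \<Longrightarrow> u \<in> rterms R V \<Longrightarrow>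
      rterm_eq R V (Plus (Plus s t) u) (Plus s (Plus t u))"
  | add_comm: "s \<in> rterms R V \<Longrightarrow> t \<in> rterms R V \<Longrightarrow> rterm_eq R V (Plus s t) (Plus t s)"
  | add_zero: "s \<in> rterms R V \<Longrightarrow> rterm_eq R V (Plus (Cst \<zero>\<^bsub>R\<^esub>) s) s"
  | add_minus: "s \<in> rterms R V \<Longrightarrow> rterm_eq R V (Plus (Minus s) s) (Cst \<zero>\<^bsub>R\<^esub>)"
  | mult_assoc: "s \<in> rterms R V \<Longrightarrow> t \<in> rterms R V \<Longrightarrow> u \<in> rterms R V \<Longrightarrow>
      rterm_eq R V (Times (Times s t) u) (Times s (Times t u))"
  | one_left: "s \<in> rterms R V \<Longrightarrow> rterm_eq R V (Times (Cst \<one>\<^bsub>R\<^esub>) s) s"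
  | one_right: "s \<in> rterms R V \<Longrightarrow> rterm_eq R V (Times s (Cst \<one>\<^bsub>R\<^esub>)) s"
  | distr_left: "s \<in> rterms R V \<Longrightarrow> t \<in> rterms R V \<Longrightarrow> u \<in> rterms R V \<Longrightarrow>
      rterm_eq R V (Times (Plus s t) u) (Plus (Times s u) (Times t u))"
  | distr_right: "s \<in> rterms R V \<Longrightarrow> t \<in> rterms R V \<Longrightarrow> u \<in> rterms R V \<Longrightarrow>
      rterm_eq R V (Times u (Plus s t)) (Plus (Times u s) (Times u t))"
  | Cst_add: "p \<in> carrier R \<Longrightarrow> q \<in> carrier R \<Longrightarrow>
      rterm_eq R V (Plus (Cst p) (Cst q)) (Cst (p \<oplus>\<^bsub>R\<^esub> q))"
  | Cst_mult: "p \<in> carrier R \<Longrightarrow> q \<in> carrier R \<Longrightarrow>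
      rterm_eq R V (Times (Cst p) (Cst q)) (Cst (p \<otimes>\<^bsub>R\<^esub> q))"

definition rclass ::
  "('a, 'm) ring_scheme \<Rightarrow> 'x set \<Rightarrow> ('a, 'x) rterm \<Rightarrow> ('a, 'x) rterm set" where
  "rclass R V s = {t. rterm_eq R V s t}"

definition free_ring ::
  "('a, 'm) ring_scheme \<Rightarrow> 'x set \<Rightarrow> ('a, 'x) rterm set ring" where
  "free_ring R V =
    \<lparr>carrier = rclass R V ` rterms R V,
     mult = (\<lambda>A B. \<Union>s\<in>A. \<Union>t\<in>B. rclass R V (Times s t)),
     one = rclass R V (Cst \<one>\<^bsub>R\<^esub>),
     zero = rclass R V (Cst \<zero>\<^bsub>R\<^esub>),
     add = (\<lambda>A B. \<Union>s\<in>A. \<Union>t\<in>B. rclass R V (Plus s t))\<rparr>"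

definition free_const ::
  "('a, 'm) ring_scheme \<Rightarrow> 'x set \<Rightarrow> 'a \<Rightarrow> ('a, 'x) rterm set" where
  "free_const R V r = rclass R V (Cst r)"

definition free_var ::
  "('a, 'm) ring_scheme \<Rightarrow> 'x set \<Rightarrow> 'x \<Rightarrow> ('a, 'x) rterm set" where
  "free_var R V x = rclass R V (Ind x)"

lemma rterm_eq_rterms:
  assumes "ring R" "rterm_eq R V s t"
  shows "s \<in> rterms R V \<and> t \<in> rterms R V"
proof -
  interpret ring R by fact
  show ?thesis
    using assms(2) by (induction rule: rterm_eq.induct) (auto intro: rterms.intros)
qed

lemma rclass_eqI: "rterm_eq R V s t \<Longrightarrow> rclass R V s = rclass R V t"
  unfolding rclass_def by (blast intro: rterm_eq.sym rterm_eq.trans)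

lemma rclass_self: "s \<in> rterms R V \<Longrightarrow> s \<in> rclass R V s"
  unfolding rclass_def by (simp add: rterm_eq.refl)

lemma free_ring_add:
  assumes "s \<in> rterms R V" "t \<in> rterms R V"
  shows "rclass R V s \<oplus>\<^bsub>free_ring R V\<^esub> rclass R V t = rclass R V (Plus s t)"
proof -
  have "rclass R V (Plus s' t') = rclass R V (Plus s t)"
    if "s' \<in> rclass R V s" "t' \<in> rclass R V t" for s' t'
    using that by (intro rclass_eqI) (auto simp: rclass_def intro: rterm_eq.sym rterm_eq.Plus rterm_eq.Times)
  then have "(\<Union>s'\<in>rclass R V s. \<Union>t'\<in>rclass R V t. rclass R V (Plus s' t')) =
      (\<Union>s'\<in>rclass R V s. \<Union>t'\<in>rclass R V t. rclass R V (Plus s t))"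
    by (intro SUP_cong) auto
  also have "\<dots> = rclass R V (Plus s t)"
    using rclass_self[OF assms(1)] rclass_self[OF assms(2)] by blast
  finally show ?thesis
    by (simp add: free_ring_def)
qed

lemma free_ring_mult:
  assumes "s \<in> rterms R V" "t \<in> rterms R V"
  shows "rclass R V s \<otimes>\<^bsub>free_ring R V\<^esub> rclass R V t = rclass R V (Times s t)"
proof -
  have "rclass R V (Times s' t') = rclass R V (Times s t)"
    if "s' \<in> rclass R V s" "t' \<in> rclass R V t" for s' t'
    using that by (intro rclass_eqI) (auto simp: rclass_def intro: rterm_eq.sym rterm_eq.Plus rterm_eq.Times)
  then have "(\<Union>s'\<in>rclass R V s. \<Union>t'\<in>rclass R V t. rclass R V (Times s' t')) =
      (\<Union>s'\<in>rclass R V s. \<Union>t'\<in>rclass R V t. rclass R V (Times s t))"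
    by (intro SUP_cong) auto
  also have "\<dots> = rclass R V (Times s t)"
    using rclass_self[OF assms(1)] rclass_self[OF assms(2)] by blast
  finally show ?thesis
    by (simp add: free_ring_def)
qed

lemma free_ring_carrier: "carrier (free_ring R V) = rclass R V ` rterms R V"
  and free_ring_one: "\<one>\<^bsub>free_ring R V\<^esub> = rclass R V (Cst \<one>\<^bsub>R\<^esub>)"
  and free_ring_zero: "\<zero>\<^bsub>free_ring R V\<^esub> = rclass R V (Cst \<zero>\<^bsub>R\<^esub>)"
  by (simp_all add: free_ring_def)

lemma ring_free_ring:
  assumes "ring R"
  shows "ring (free_ring R V)"
proof -
  interpret ring R by fact
  note ops = free_ring_carrier free_ring_one free_ring_zero free_ring_add free_ring_mult
  note ax = rterms.intros imageI
  note eqs = rterm_eq.add_assoc[THEN rclass_eqI]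
    rterm_eq.add_zero[THEN rclass_eqI] rterm_eq.mult_assoc[THEN rclass_eqI]
    rterm_eq.one_left[THEN rclass_eqI] rterm_eq.one_right[THEN rclass_eqI]
    rterm_eq.distr_left[THEN rclass_eqI] rterm_eq.distr_right[THEN rclass_eqI]
  show ?thesis
  proof (rule ringI)
    show "abelian_group (free_ring R V)"
    proof (rule abelian_groupI)
      fix x assume "x \<in> carrier (free_ring R V)"
      then obtain s where s: "s \<in> rterms R V" "x = rclass R V s"
        by (auto simp: ops)
      have "rclass R V (Minus s) \<oplus>\<^bsub>free_ring R V\<^esub> x = \<zero>\<^bsub>free_ring R V\<^esub>"
        using s by (simp add: ops ax rclass_eqI[OF rterm_eq.add_minus])
      moreover have "rclass R V (Minus s) \<in> carrier (free_ring R V)"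
        unfolding free_ring_carrier by (intro imageI rterms.Minus s(1))
      ultimately show "\<exists>y\<in>carrier (free_ring R V). y \<oplus>\<^bsub>free_ring R V\<^esub> x = \<zero>\<^bsub>free_ring R V\<^esub>"
        by blast
    next
      fix x y assume "x \<in> carrier (free_ring R V)" "y \<in> carrier (free_ring R V)"
      then obtain s t where st: "s \<in> rterms R V" "t \<in> rterms R V"
        and "x = rclass R V s" "y = rclass R V t"
        by (auto simp: ops)
      with rclass_eqI[OF rterm_eq.add_comm[OF st]]
      show "x \<oplus>\<^bsub>free_ring R V\<^esub> y = y \<oplus>\<^bsub>free_ring R V\<^esub> x"
        by (simp only: free_ring_add)
    qed (auto simp: ops ax eqs)
    show "Group.monoid (free_ring R V)"
      by (rule Group.monoidI) (auto simp: ops ax eqs)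
  qed (auto simp: ops ax eqs)
qed

lemma free_const_hom:
  assumes "ring R"
  shows "free_const R V \<in> ring_hom R (free_ring R V)"
proof -
  interpret ring R by fact
  show ?thesis
    by (rule ring_hom_memI)
      (auto simp: free_const_def free_ring_carrier free_ring_one free_ring_add free_ring_mult
        rterms.intros rclass_eqI[OF rterm_eq.Cst_add] rclass_eqI[OF rterm_eq.Cst_mult])
qed

primrec rterm_eval ::
  "('b, 'n) ring_scheme \<Rightarrow> ('a \<Rightarrow> 'b) \<Rightarrow> ('x \<Rightarrow> 'b) \<Rightarrow> ('a, 'x) rterm \<Rightarrow> 'b" where
  "rterm_eval B \<psi> \<zeta> (Cst r) = \<psi> r"
| "rterm_eval B \<psi> \<zeta> (Ind x) = \<zeta> x"
| "rterm_eval B \<psi> \<zeta> (Plus s t) = rterm_eval B \<psi> \<zeta> s \<oplus>\<^bsub>B\<^esub> rterm_eval B \<psi> \<zeta> t"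
| "rterm_eval B \<psi> \<zeta> (Times s t) = rterm_eval B \<psi> \<zeta> s \<otimes>\<^bsub>B\<^esub> rterm_eval B \<psi> \<zeta> t"
| "rterm_eval B \<psi> \<zeta> (Minus s) = \<ominus>\<^bsub>B\<^esub> rterm_eval B \<psi> \<zeta> s"

theorem free_ring_universal:
  fixes R :: "('a, 'm) ring_scheme" and B :: "('b, 'n) ring_scheme"
    and V :: "'x set" and \<psi> :: "'a \<Rightarrow> 'b" and \<zeta> :: "'x \<Rightarrow> 'b"
  assumes R: "ring R" and B: "ring B" and \<psi>: "\<psi> \<in> ring_hom R B" and \<zeta>: "\<zeta> \<in> V \<rightarrow> carrier B"
  shows "\<exists>h \<in> ring_hom (free_ring R V) B.
    (\<forall>r\<in>carrier R. h (free_const R V r) = \<psi> r) \<and> (\<forall>x\<in>V. h (free_var R V x) = \<zeta> x) \<and>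
    (\<forall>h' \<in> ring_hom (free_ring R V) B.
      (\<forall>r\<in>carrier R. h' (free_const R V r) = \<psi> r) \<longrightarrow> (\<forall>x\<in>V. h' (free_var R V x) = \<zeta> x) \<longrightarrow>
      (\<forall>u\<in>carrier (free_ring R V). h' u = h u))"
proof -
  interpret R: ring R by fact
  interpret B: ring B by fact
  interpret F: ring "free_ring R V" by (rule ring_free_ring[OF R])
  let ?ev = "rterm_eval B \<psi> \<zeta>"
  interpret \<psi>: ring_hom_ring R B \<psi> by (rule ring_hom_ringI2[OF R B \<psi>])
  have ev_closed: "?ev s \<in> carrier B" if "s \<in> rterms R V" for s
    using that \<zeta> by (induction rule: rterms.induct) auto
  have ev_cong: "?ev s = ?ev t" if "rterm_eq R V s t" for s t
    using that
    by (induction rule: rterm_eq.induct)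
      (auto simp: ev_closed B.a_assoc B.m_assoc B.l_distr B.r_distr B.l_neg
        intro: B.a_comm)
  define h where "h A = ?ev (SOME s. s \<in> A)" for A
  have h: "h (rclass R V s) = ?ev s" if "s \<in> rterms R V" for s
  proof -
    have "(SOME t. t \<in> rclass R V s) \<in> rclass R V s"
      using rclass_self[OF that] by (rule someI)
    then show ?thesis
      unfolding h_def by (auto simp: rclass_def dest: ev_cong)
  qed
  have hom: "h \<in> ring_hom (free_ring R V) B"
    by (rule ring_hom_memI)
      (auto simp: free_ring_carrier free_ring_one free_ring_add free_ring_mult
        rterms.intros h ev_closed)
  have uniq: "h' u = h u"
    if h': "h' \<in> ring_hom (free_ring R V) B"
      and c: "\<forall>r\<in>carrier R. h' (free_const R V r) = \<psi> r"
      and v: "\<forall>x\<in>V. h' (free_var R V x) = \<zeta> x"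
      and u: "u \<in> carrier (free_ring R V)" for h' u
  proof -
    interpret h': ring_hom_ring "free_ring R V" B h'
      by (rule ring_hom_ringI2[OF F.ring_axioms B h'])
    have cl: "rclass R V s \<in> carrier (free_ring R V)" if "s \<in> rterms R V" for s
      using that by (simp add: free_ring_carrier)
    have "h' (rclass R V s) = ?ev s" if "s \<in> rterms R V" for s
      using that
    proof (induction rule: rterms.induct)
      case (Minus s)
      have "rclass R V (Minus s) \<oplus>\<^bsub>free_ring R V\<^esub> rclass R V s = \<zero>\<^bsub>free_ring R V\<^esub>"
        using Minus by (simp add: free_ring_zero free_ring_add rterms.intros
            rclass_eqI[OF rterm_eq.add_minus])
      then have "rclass R V (Minus s) = \<ominus>\<^bsub>free_ring R V\<^esub> rclass R V s"
        using Minus by (intro F.minus_equality[symmetric]) (auto intro: cl rterms.intros)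
      then show ?case using Minus by (simp add: cl)
    qed (use c v in \<open>simp_all add: free_const_def free_var_def cl
          flip: free_ring_add free_ring_mult\<close>)
    then show ?thesis using u h by (auto simp: free_ring_carrier)
  qed
  show ?thesis
  proof (intro bexI[of _ h] conjI ballI impI)
    show "h (free_const R V r) = \<psi> r" if "r \<in> carrier R" for r
      using that by (simp add: free_const_def rterms.Cst h)
    show "h (free_var R V x) = \<zeta> x" if "x \<in> V" for x
      using that by (simp add: free_var_def rterms.Ind h)
  qed (rule uniq hom; assumption)+
qed


subsection \<open>Universal inversion\<close>

text \<open>The indeterminate \<open>x\<^sub>n\<close> is \<open>free_var R N n\<close>: the set \<open>N\<close> indexes itself.\<close>

definition inv_ideal ::
  "('a, 'm) ring_scheme \<Rightarrow> 'a set \<Rightarrow> ('a, 'a) rterm set set" where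
  "inv_ideal R N = (let F = free_ring R N in
     Idl\<^bsub>F\<^esub> ({free_var R N n \<otimes>\<^bsub>F\<^esub> free_const R N n \<ominus>\<^bsub>F\<^esub> \<one>\<^bsub>F\<^esub> | n. n \<in> N} \<union>
           {free_const R N n \<otimes>\<^bsub>F\<^esub> free_var R N n \<ominus>\<^bsub>F\<^esub> \<one>\<^bsub>F\<^esub> | n. n \<in> N}))"

definition inv_ring ::
  "('a, 'm) ring_scheme \<Rightarrow> 'a set \<Rightarrow> ('a, 'a) rterm set set ring" where
  "inv_ring R N = free_ring R N Quot inv_ideal R N"

definition inv_map ::
  "('a, 'm) ring_scheme \<Rightarrow> 'a set \<Rightarrow> 'a \<Rightarrow> ('a, 'a) rterm set set" where
  "inv_map R N r = inv_ideal R N +>\<^bsub>free_ring R N\<^esub> free_const R N r"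

end

theory Submission
  imports Defs
begin

text \<open>
  The morphism \<open>\<phi>\<close> factors through \<open>R Quot \<aa>\<close> because \<open>\<aa>\<close> is its kernel, and it lands in the
  subring \<open>T\<close> of \<open>S\<close>. Every \<open>m \<in> M\<close> has an invertible image in \<open>S\<close>, and \<open>T\<close> is made to contain
  the inverse, so the induced morphism from \<open>R Quot \<aa>\<close> to \<open>T\<close> inverts the image of \<open>M\<close>. The
  universal property of \<open>S\<^bsub>(R/\<aa>, M/\<aa>)\<^esub>\<close> (\<open>inv_ring_universal\<close>) then yields \<open>g\<close>.

  The image of \<open>g\<close> is a subring of \<open>S\<close> that contains all generators of \<open>T\<close>, since a ring morphism
  carries the inverse of \<open>\<chi> (\<pi> m)\<close> to the inverse of \<open>\<phi> m\<close>. Hence \<open>g\<close> is onto \<open>T\<close>, and a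
  surjective morphism is an epimorphism, whatever the test rings. Uniqueness of \<open>g\<close> says
  that \<open>\<chi>\<close> itself is an epimorphism (\<open>inv_map_epi\<close>): inverses are unique, so the values of a morphism
  on the adjoined inverses are forced by its values on the image of \<open>\<chi>\<close>.

  Since \<open>T\<close> sits in \<open>S\<close>, where \<open>\<one> \<noteq> \<zero>\<close>, the existence of \<open>g\<close> is also what shows that
  the universal localization is not the zero ring, which for an arbitrary set of elements may fail.
\<close>

lemma ring_hom_inv:
  assumes "ring A" "ring B" "f \<in> ring_hom A B" "u \<in> Units A"
  shows "f u \<in> Units B" and "f (inv\<^bsub>A\<^esub> u) = inv\<^bsub>B\<^esub> (f u)"
proof -
  interpret A: ring A by fact
  interpret B: ring B by fact
  note f = ring_hom_memE[OF assms(3)]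
  have u: "u \<in> carrier A" "inv\<^bsub>A\<^esub> u \<in> carrier A"
    using assms(4) by auto
  have l: "f (inv\<^bsub>A\<^esub> u) \<otimes>\<^bsub>B\<^esub> f u = \<one>\<^bsub>B\<^esub>" and r: "f u \<otimes>\<^bsub>B\<^esub> f (inv\<^bsub>A\<^esub> u) = \<one>\<^bsub>B\<^esub>"
    using f(2)[OF u(2,1)] f(2)[OF u] f(4) assms(4) by simp_all
  show "f u \<in> Units B"
    using l r f(1)[OF u(1)] f(1)[OF u(2)] unfolding Units_def by blast
  show "f (inv\<^bsub>A\<^esub> u) = inv\<^bsub>B\<^esub> (f u)"
    by (rule B.inv_unique'[OF f(1)[OF u(1)] f(1)[OF u(2)] r l])
qed

lemma quotient_factor:
  fixes I :: "'a set"
  assumes "ideal I A" "ring B" "f \<in> ring_hom A B" and ker: "I \<subseteq> a_kernel A B f"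
  shows "\<exists>k \<in> ring_hom (A Quot I) B. \<forall>x\<in>carrier A. k (I +>\<^bsub>A\<^esub> x) = f x"
proof -
  interpret I: ideal I A by fact
  interpret B: ring B by fact
  interpret f: ring_hom_ring A B f
    by (rule ring_hom_ringI2[OF I.ring_axioms assms(2,3)])
  define k where "k X = the_elem (f ` X)" for X
  have k: "k (I +>\<^bsub>A\<^esub> x) = f x" if x: "x \<in> carrier A" for x
  proof -
    have "f y = f x" if y: "y \<in> I +>\<^bsub>A\<^esub> x" for y
    proof -
      obtain i where i: "i \<in> I" "y = i \<oplus>\<^bsub>A\<^esub> x"
        using y by (auto simp: a_r_coset_def')
      have "i \<in> carrier A" "f i = \<zero>\<^bsub>B\<^esub>"
        using subsetD[OF ker i(1)] unfolding a_kernel_def' by blast+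
      then show ?thesis
        using i(2) x by simp
    qed
    then have "f ` (I +>\<^bsub>A\<^esub> x) = {f x}"
      using I.a_rcos_self[OF x] by blast
    then show ?thesis
      by (simp add: k_def)
  qed
  note proj = ring_hom_memE[OF I.rcos_ring_hom]
  have rep: "\<exists>x\<in>carrier A. X = I +>\<^bsub>A\<^esub> x" if "X \<in> carrier (A Quot I)" for X
    using that by (auto simp: FactRing_def A_RCOSETS_def')
  have "k \<in> ring_hom (A Quot I) B"
  proof (rule ring_hom_memI)
    fix X Y assume "X \<in> carrier (A Quot I)" "Y \<in> carrier (A Quot I)"
    then obtain x y where x: "x \<in> carrier A" "X = I +>\<^bsub>A\<^esub> x" and y: "y \<in> carrier A" "Y = I +>\<^bsub>A\<^esub> y"
      using rep by metis
    show "k (X \<otimes>\<^bsub>A Quot I\<^esub> Y) = k X \<otimes>\<^bsub>B\<^esub> k Y" "k (X \<oplus>\<^bsub>A Quot I\<^esub> Y) = k X \<oplus>\<^bsub>B\<^esub> k Y"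
      using x y by (simp_all add: k flip: proj(2,3))
  qed (use rep k proj(4) in force)+
  with k show ?thesis by blast
qed

lemma surjective_imp_ring_epi:
  assumes "ring_mor A B f" "f ` carrier A = carrier B"
  shows "ring_epi TYPE('c) A B f"
  using assms(1) by (auto simp: ring_epi_def simp flip: assms(2))

section \<open>The universal property of universal inversion\<close>

context
  fixes Q :: "('a, 'm) ring_scheme" and N :: "'a set"
  assumes Q: "ring Q" and N: "N \<subseteq> carrier Q"
begin

abbreviation (input) "F \<equiv> free_ring Q N"

lemma free_const_closed: "q \<in> carrier Q \<Longrightarrow> free_const Q N q \<in> carrier F"
  by (rule ring_hom_closed[OF free_const_hom[OF Q]])

lemma free_var_closed: "n \<in> N \<Longrightarrow> free_var Q N n \<in> carrier F"
  by (simp add: free_var_def free_ring_carrier rterms.Ind)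

lemma inv_relators_closed:
  "{free_var Q N n \<otimes>\<^bsub>F\<^esub> free_const Q N n \<ominus>\<^bsub>F\<^esub> \<one>\<^bsub>F\<^esub> | n. n \<in> N} \<union>
   {free_const Q N n \<otimes>\<^bsub>F\<^esub> free_var Q N n \<ominus>\<^bsub>F\<^esub> \<one>\<^bsub>F\<^esub> | n. n \<in> N} \<subseteq> carrier F"
proof -
  interpret F: ring F by (rule ring_free_ring[OF Q])
  show ?thesis
    using free_const_closed free_var_closed N by auto
qed

lemma ideal_inv_ideal: "ideal (inv_ideal Q N) F"
  unfolding inv_ideal_def Let_def
  by (rule ring.genideal_ideal[OF ring_free_ring[OF Q] inv_relators_closed])

lemma ring_inv_ring: "ring (inv_ring Q N)"
  unfolding inv_ring_def by (rule ideal.quotient_is_ring[OF ideal_inv_ideal])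

lemma inv_ring_proj_hom: "(\<lambda>u. inv_ideal Q N +>\<^bsub>F\<^esub> u) \<in> ring_hom F (inv_ring Q N)"
  unfolding inv_ring_def by (rule ideal.rcos_ring_hom[OF ideal_inv_ideal])

lemma inv_map_hom: "inv_map Q N \<in> ring_hom Q (inv_ring Q N)"
  using ring_hom_trans[OF free_const_hom[OF Q] inv_ring_proj_hom]
  by (simp add: inv_map_def[abs_def] comp_def)

lemma inv_map_Units:
  assumes n: "n \<in> N"
  shows "inv_map Q N n \<in> Units (inv_ring Q N)"
    and "inv\<^bsub>inv_ring Q N\<^esub> (inv_map Q N n) = inv_ideal Q N +>\<^bsub>F\<^esub> free_var Q N n"
proof -
  interpret F: ring F by (rule ring_free_ring[OF Q])
  interpret L: ring "inv_ring Q N" by (rule ring_inv_ring)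
  let ?p = "\<lambda>u. inv_ideal Q N +>\<^bsub>F\<^esub> u"
  let ?c = "free_const Q N n" and ?x = "free_var Q N n"
  note p = ring_hom_memE[OF inv_ring_proj_hom]
  have cl: "?c \<in> carrier F" "?x \<in> carrier F"
    using n N by (auto intro: free_const_closed free_var_closed)
  have "?x \<otimes>\<^bsub>F\<^esub> ?c \<ominus>\<^bsub>F\<^esub> \<one>\<^bsub>F\<^esub> \<in> inv_ideal Q N" "?c \<otimes>\<^bsub>F\<^esub> ?x \<ominus>\<^bsub>F\<^esub> \<one>\<^bsub>F\<^esub> \<in> inv_ideal Q N"
    unfolding inv_ideal_def Let_def
    by (rule subsetD[OF F.genideal_self[OF inv_relators_closed]], use n in blast)+
  then have "?p (?x \<otimes>\<^bsub>F\<^esub> ?c) = ?p \<one>\<^bsub>F\<^esub>" "?p (?c \<otimes>\<^bsub>F\<^esub> ?x) = ?p \<one>\<^bsub>F\<^esub>"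
    using cl by (simp_all add: F.quotient_eq_iff_same_a_r_cos[OF ideal_inv_ideal])
  then have inv: "?p ?x \<otimes>\<^bsub>inv_ring Q N\<^esub> ?p ?c = \<one>\<^bsub>inv_ring Q N\<^esub>"
      "?p ?c \<otimes>\<^bsub>inv_ring Q N\<^esub> ?p ?x = \<one>\<^bsub>inv_ring Q N\<^esub>"
    using p(2) p(4) cl by auto
  show "inv_map Q N n \<in> Units (inv_ring Q N)"
    unfolding inv_map_def Units_def using inv p(1) cl by blast
  show "inv\<^bsub>inv_ring Q N\<^esub> (inv_map Q N n) = ?p ?x"
    unfolding inv_map_def
    by (rule L.inv_unique'[OF p(1)[OF cl(1)] p(1)[OF cl(2)] inv(2,1), symmetric])
qed

text \<open>
  Sending each indeterminate to the inverse that it is to become extends \<open>\<psi>\<close> to the free ring, and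
  the extension kills the defining relators.
\<close>

lemma inv_ring_universal:
  assumes B: "ring B" and \<psi>: "\<psi> \<in> ring_hom Q B" and units: "\<And>n. n \<in> N \<Longrightarrow> \<psi> n \<in> Units B"
  shows "\<exists>g \<in> ring_hom (inv_ring Q N) B. \<forall>q\<in>carrier Q. g (inv_map Q N q) = \<psi> q"
proof -
  interpret B: ring B by fact
  interpret F: ring F by (rule ring_free_ring[OF Q])
  have "(\<lambda>n. inv\<^bsub>B\<^esub> (\<psi> n)) \<in> N \<rightarrow> carrier B"
    using units by auto
  from free_ring_universal[OF Q B \<psi> this] obtain h where h: "h \<in> ring_hom F B"
    and hc: "\<And>q. q \<in> carrier Q \<Longrightarrow> h (free_const Q N q) = \<psi> q"
    and hv: "\<And>n. n \<in> N \<Longrightarrow> h (free_var Q N n) = inv\<^bsub>B\<^esub> (\<psi> n)"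
    by blast
  interpret h: ring_hom_ring F B h
    by (rule ring_hom_ringI2[OF F.ring_axioms B h])
  have "inv_ideal Q N \<subseteq> a_kernel F B h"
    unfolding inv_ideal_def Let_def
  proof (rule F.genideal_minimal[OF h.kernel_is_ideal], rule subsetI)
    fix z assume z: "z \<in> {free_var Q N n \<otimes>\<^bsub>F\<^esub> free_const Q N n \<ominus>\<^bsub>F\<^esub> \<one>\<^bsub>F\<^esub> | n. n \<in> N} \<union>
      {free_const Q N n \<otimes>\<^bsub>F\<^esub> free_var Q N n \<ominus>\<^bsub>F\<^esub> \<one>\<^bsub>F\<^esub> | n. n \<in> N}"
    then have "z \<in> carrier F"
      using inv_relators_closed by blast
    moreover have "h z = \<zero>\<^bsub>B\<^esub>"
    proof -
      obtain n where n: "n \<in> N"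
        and z: "z = free_var Q N n \<otimes>\<^bsub>F\<^esub> free_const Q N n \<ominus>\<^bsub>F\<^esub> \<one>\<^bsub>F\<^esub> \<or>
          z = free_const Q N n \<otimes>\<^bsub>F\<^esub> free_var Q N n \<ominus>\<^bsub>F\<^esub> \<one>\<^bsub>F\<^esub>"
        using z by blast
      have "n \<in> carrier Q" "free_const Q N n \<in> carrier F" "free_var Q N n \<in> carrier F"
        using n N free_const_closed free_var_closed by auto
      then show ?thesis
        using z units[OF n] hc[of n] hv[OF n] B.r_neg[OF B.one_closed]
        by (elim disjE) (simp_all add: a_minus_def)
    qed
    ultimately show "z \<in> a_kernel F B h"
      unfolding a_kernel_def' by simp
  qed
  from quotient_factor[OF ideal_inv_ideal B h this]
  obtain g where "g \<in> ring_hom (inv_ring Q N) B"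
    and "\<And>u. u \<in> carrier F \<Longrightarrow> g (inv_ideal Q N +>\<^bsub>F\<^esub> u) = h u"
    by (auto simp flip: inv_ring_def)
  then show ?thesis
    by (intro bexI[of _ g]) (auto simp: inv_map_def hc free_const_closed)
qed

text \<open>
  Two morphisms that agree on the image of \<open>Q\<close> also agree on the indeterminates, whose classes are
  inverses of elements of that image; the uniqueness part of the universal property of
  the free ring does the rest.
\<close>

lemma inv_map_epi:
  assumes B: "ring B" and k: "k \<in> ring_hom (inv_ring Q N) B" and k': "k' \<in> ring_hom (inv_ring Q N) B"
    and eq: "\<And>q. q \<in> carrier Q \<Longrightarrow> k (inv_map Q N q) = k' (inv_map Q N q)"
    and y: "y \<in> carrier (inv_ring Q N)"
  shows "k y = k' y"
proof -
  let ?p = "\<lambda>u. inv_ideal Q N +>\<^bsub>F\<^esub> u"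
  have var: "k (?p (free_var Q N n)) = k' (?p (free_var Q N n))" if n: "n \<in> N" for n
    using ring_hom_inv(2)[OF ring_inv_ring B k inv_map_Units(1)[OF n]]
      ring_hom_inv(2)[OF ring_inv_ring B k' inv_map_Units(1)[OF n]] eq n N
    by (auto simp: inv_map_Units(2))
  have kp: "k \<circ> ?p \<in> ring_hom F B" and kp': "k' \<circ> ?p \<in> ring_hom F B"
    using ring_hom_trans[OF inv_ring_proj_hom] k k' by blast+
  have \<psi>: "(\<lambda>q. k (inv_map Q N q)) \<in> ring_hom Q B"
    using ring_hom_trans[OF inv_map_hom k] by (simp add: comp_def)
  have \<zeta>: "(\<lambda>n. k (?p (free_var Q N n))) \<in> N \<rightarrow> carrier B"
    using ring_hom_closed[OF kp] free_var_closed by auto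
  obtain u where u: "u \<in> carrier F" "y = ?p u"
    using y by (auto simp: inv_ring_def FactRing_def A_RCOSETS_def')
  from free_ring_universal[OF Q B \<psi> \<zeta>] obtain h where
    h: "\<forall>h' \<in> ring_hom F B. (\<forall>q\<in>carrier Q. h' (free_const Q N q) = k (inv_map Q N q)) \<longrightarrow>
      (\<forall>n\<in>N. h' (free_var Q N n) = k (?p (free_var Q N n))) \<longrightarrow> (\<forall>u\<in>carrier F. h' u = h u)"
    by blast
  have "(k \<circ> ?p) u = h u"
    using h[rule_format, OF kp] u(1) by (simp add: inv_map_def)
  moreover have "(k' \<circ> ?p) u = h u"
    using h[rule_format, OF kp'] u(1) var eq by (simp add: inv_map_def)
  ultimately show ?thesis
    using u(2) by simp
qed

end

section \<open>The factorization\<close>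

theorem theorem7p3:
  fixes R :: "('a, 'm) ring_scheme" and S :: "('b, 'n) ring_scheme"
    and \<phi> :: "'a \<Rightarrow> 'b" and \<aa> M :: "'a set"
  assumes "ring_mor R S \<phi>"
    and "(\<aa>, M) = hom_pair R S \<phi>"
  defines "Q \<equiv> R Quot \<aa>"
    and "\<pi> \<equiv> \<lambda>r. \<aa> +>\<^bsub>R\<^esub> r"
  defines "L \<equiv> inv_ring Q (\<pi> ` M)"
    and "\<chi> \<equiv> inv_map Q (\<pi> ` M)"
    and "T \<equiv> S\<lparr>carrier := generate_ring S (\<phi> ` carrier R \<union> {inv\<^bsub>S\<^esub> (\<phi> m) | m. m \<in> M})\<rparr>"
    and "\<epsilon> \<equiv> \<lambda>t::'b. t"
  shows "ring_mor R Q \<pi> \<and> ring_mor Q L \<chi> \<and> ring_mor T S \<epsilon> \<and>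
    (\<exists>g. ring_epi TYPE('c) L T g \<and> g ` carrier L = carrier T \<and>
         (\<forall>r\<in>carrier R. \<phi> r = \<epsilon> (g (\<chi> (\<pi> r)))) \<and>
         (\<forall>g'. ring_mor L T g' \<and> (\<forall>r\<in>carrier R. \<phi> r = \<epsilon> (g' (\<chi> (\<pi> r)))) \<longrightarrow>
               (\<forall>y\<in>carrier L. g' y = g y)))"
proof -
  have R: "ring R" and R1: "\<one>\<^bsub>R\<^esub> \<noteq> \<zero>\<^bsub>R\<^esub>" and S: "ring S" and S1: "\<one>\<^bsub>S\<^esub> \<noteq> \<zero>\<^bsub>S\<^esub>"
    and \<phi>: "\<phi> \<in> ring_hom R S"
    using assms(1) by (auto simp: ring_mor_def nz_ring_def)
  have \<aa>: "\<aa> = a_kernel R S \<phi>" and M: "M = {r \<in> carrier R. \<phi> r \<in> Units S}"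
    using assms(2) by (auto simp: hom_pair_def)
  interpret S: ring S by (rule S)
  interpret \<phi>: ring_hom_ring R S \<phi> by (rule ring_hom_ringI2[OF R S \<phi>])
  have ideal: "ideal \<aa> R"
    unfolding \<aa> by (rule \<phi>.kernel_is_ideal)

  have Q: "ring Q" and \<pi>: "\<pi> \<in> ring_hom R Q"
    unfolding Q_def \<pi>_def
    by (rule ideal.quotient_is_ring[OF ideal], rule ideal.rcos_ring_hom[OF ideal])
  have Q_rep: "\<exists>r\<in>carrier R. q = \<pi> r" if "q \<in> carrier Q" for q
    using that by (auto simp: Q_def \<pi>_def FactRing_def A_RCOSETS_def')
  have N: "\<pi> ` M \<subseteq> carrier Q"
    using ring_hom_closed[OF \<pi>] by (auto simp: M)
  have L: "ring L" and \<chi>: "\<chi> \<in> ring_hom Q L"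
    unfolding L_def \<chi>_def by (rule ring_inv_ring[OF Q N], rule inv_map_hom[OF Q N])

  let ?G = "\<phi> ` carrier R \<union> {inv\<^bsub>S\<^esub> (\<phi> m) | m. m \<in> M}"
  have G: "?G \<subseteq> carrier S"
    by (auto simp: M)
  have T: "ring T"
    unfolding T_def by (rule S.generate_ring_is_ring[OF G])
  have T_carrier: "carrier T = generate_ring S ?G" and T_sub: "carrier T \<subseteq> carrier S"
    using S.generate_ring_incl[OF G] by (auto simp: T_def)
  have T_ops: "x \<otimes>\<^bsub>T\<^esub> y = x \<otimes>\<^bsub>S\<^esub> y" "x \<oplus>\<^bsub>T\<^esub> y = x \<oplus>\<^bsub>S\<^esub> y" "\<one>\<^bsub>T\<^esub> = \<one>\<^bsub>S\<^esub>" "\<zero>\<^bsub>T\<^esub> = \<zero>\<^bsub>S\<^esub>" for x y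
    by (simp_all add: T_def)
  have T_gen: "?G \<subseteq> carrier T"
    unfolding T_carrier by (auto intro: generate_ring.incl)
  have \<epsilon>: "\<epsilon> \<in> ring_hom T S"
    unfolding \<epsilon>_def by (rule ring_hom_memI) (use T_sub in \<open>auto simp: T_ops\<close>)

  have \<phi>T: "\<phi> \<in> ring_hom R T"
    by (rule ring_hom_memI) (use T_gen in \<open>auto simp: T_ops\<close>)
  have "\<aa> \<subseteq> a_kernel R T \<phi>"
    unfolding \<aa> a_kernel_def' T_ops using T_gen by blast
  from quotient_factor[OF ideal T \<phi>T this]
  obtain \<psi> where \<psi>: "\<psi> \<in> ring_hom Q T" and \<psi>\<pi>: "\<And>r. r \<in> carrier R \<Longrightarrow> \<psi> (\<pi> r) = \<phi> r"
    unfolding Q_def \<pi>_def by blast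
  have "\<psi> n \<in> Units T" if n: "n \<in> \<pi> ` M" for n
  proof -
    obtain m where m: "m \<in> M" "n = \<pi> m"
      using n by blast
    then have "m \<in> carrier R" and unit: "\<phi> m \<in> Units S"
      by (auto simp: M)
    moreover have "\<phi> m \<in> carrier T" "inv\<^bsub>S\<^esub> (\<phi> m) \<in> carrier T"
      using T_gen m(1) \<open>m \<in> carrier R\<close> by auto
    moreover have "\<phi> m \<otimes>\<^bsub>T\<^esub> inv\<^bsub>S\<^esub> (\<phi> m) = \<one>\<^bsub>T\<^esub>" "inv\<^bsub>S\<^esub> (\<phi> m) \<otimes>\<^bsub>T\<^esub> \<phi> m = \<one>\<^bsub>T\<^esub>"
      using unit by (simp_all add: T_ops)
    ultimately show ?thesis
      using \<psi>\<pi> m(2) unfolding Units_def by auto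
  qed
  from inv_ring_universal[OF Q N T \<psi> this]
  obtain g where g: "g \<in> ring_hom L T" and g\<chi>: "\<And>q. q \<in> carrier Q \<Longrightarrow> g (\<chi> q) = \<psi> q"
    unfolding L_def \<chi>_def by blast
  have fact: "\<phi> r = g (\<chi> (\<pi> r))" if "r \<in> carrier R" for r
    using g\<chi> \<psi>\<pi> ring_hom_closed[OF \<pi>] that by simp

  \<comment> \<open>A ring that maps to a nonzero ring is nonzero; along \<open>\<psi>\<close> and \<open>g\<close> this reaches \<open>Q\<close> and \<open>L\<close>.\<close>
  have nz: "nz_ring A" if "ring A" "f \<in> ring_hom A T" for A :: "('z, 'y) ring_scheme" and f
    using that S1 ring_hom_one[OF that(2)] ring_hom_zero[OF that(2,1) T] T_ops
    by (metis nz_ring_def)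
  have nzR: "nz_ring R" and nzS: "nz_ring S" and nzT: "nz_ring T"
    using R R1 S S1 T T_ops by (auto simp: nz_ring_def)
  have nzQ: "nz_ring Q" and nzL: "nz_ring L"
    using nz[OF Q \<psi>] nz[OF L g] by auto

  \<comment> \<open>Subrings and inverses are taken in \<open>S\<close>, where \<open>T\<close> is generated.\<close>
  have gS: "g \<in> ring_hom L S"
    using ring_hom_trans[OF g \<epsilon>] by (simp add: \<epsilon>_def comp_def)
  interpret g: ring_hom_ring L S g by (rule ring_hom_ringI2[OF L S gS])
  have img: "subring (g ` carrier L) S"
    by (rule S.ring_incl_imp_subring) (auto intro: g.img_is_ring)
  have "?G \<subseteq> g ` carrier L"
  proof -
    have "\<phi> r \<in> g ` carrier L" if "r \<in> carrier R" for r
      using fact[OF that] ring_hom_closed[OF \<chi>] ring_hom_closed[OF \<pi>] that by simp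
    moreover have "inv\<^bsub>S\<^esub> (\<phi> m) \<in> g ` carrier L" if m: "m \<in> M" for m
    proof -
      have unit: "\<chi> (\<pi> m) \<in> Units L"
        unfolding L_def \<chi>_def by (rule inv_map_Units(1)[OF Q N]) (use m in blast)
      then have "inv\<^bsub>S\<^esub> (\<phi> m) = g (inv\<^bsub>L\<^esub> (\<chi> (\<pi> m)))"
        using ring_hom_inv(2)[OF L S gS] fact[of m] m by (simp add: M)
      then show ?thesis
        using unit by simp
    qed
    ultimately show ?thesis by blast
  qed
  then have "carrier T \<subseteq> g ` carrier L"
    unfolding T_carrier by (rule S.generate_ring_min_subring1[OF G img])
  then have surj: "g ` carrier L = carrier T"
    using ring_hom_closed[OF g] by blast

  have uniq: "g' y = g y"
    if g': "g' \<in> ring_hom L T" and fact': "\<forall>r\<in>carrier R. \<phi> r = g' (\<chi> (\<pi> r))"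
      and y: "y \<in> carrier L" for g' y
  proof (rule inv_map_epi[OF Q N T g'[unfolded L_def] g[unfolded L_def] _ y[unfolded L_def]])
    fix q assume "q \<in> carrier Q"
    then obtain r where "r \<in> carrier R" "q = \<pi> r"
      using Q_rep by blast
    then show "g' (inv_map Q (\<pi> ` M) q) = g (inv_map Q (\<pi> ` M) q)"
      using fact' fact by (simp flip: \<chi>_def)
  qed

  have "ring_mor L T g"
    using nzL nzT g by (simp add: ring_mor_def)
  then have "ring_epi TYPE('c) L T g"
    by (rule surjective_imp_ring_epi[OF _ surj])
  moreover have "ring_mor R Q \<pi>" "ring_mor Q L \<chi>" "ring_mor T S \<epsilon>"
    using nzR nzQ nzL nzT nzS \<pi> \<chi> \<epsilon> by (simp_all add: ring_mor_def)
  moreover have "\<forall>r\<in>carrier R. \<phi> r = \<epsilon> (g (\<chi> (\<pi> r)))"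
    using fact by (simp add: \<epsilon>_def)
  moreover have "\<forall>g'. ring_mor L T g' \<and> (\<forall>r\<in>carrier R. \<phi> r = \<epsilon> (g' (\<chi> (\<pi> r)))) \<longrightarrow>
      (\<forall>y\<in>carrier L. g' y = g y)"
    using uniq by (simp add: ring_mor_def \<epsilon>_def)
  ultimately show ?thesis
    using surj by blast
qed

end
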